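(* Let $n\ge 3$, let $C_1,\dots,C_n$ be events in a probability space, and let $\pi$ be an ordering (permutation) of $\{1,\dots,n\}$. Put $P_i=P[C_{\pi(i)}]$ and $P_{ij}=P_{ji}=P[C_{\pi(i)}\cap C_{\pi(j)}]$. Suppose there exist distinct indices $a,b,c\in\{1,\dots,n\}$ with $a,b<c$ such that $$P_{ac}=\max_{i<c}P_{ic}\;\ge\;P_{bc}\;>\;P_{ab}.$$ Then the level 2 bound is strictly less than the level 1 bound in that ordering: $B_2(\pi)<B_1(\pi)$.
   Context: With $P_i,P_{ij}$ as in the claim (they depend on $\pi$) and $[x]^+=\max(x,0)$, the level 1 and level 2 bounds in the ordering $\pi$ are $$B_1(\pi)=P_1+P_2-P_{12}+\sum_{i=3}^n\Big[P_i-\max_{1\le j<i}P_{ji}\Big],$$ $$B_2(\pi)=P_1+P_2-P_{12}+\sum_{i=3}^n\Big[P_i-\max_{1\le j<l<i}\big\{P_{ji}+P_{li}-\min(P_{ji},P_{li},P_{lj})\big\}\Big]^+.$$ *)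

theory Defs
  imports "HOL-Probability.Probability" "HOL-Combinatorics.Permutations"
begin

definition single_prob :: "'a measure \<Rightarrow> (nat \<Rightarrow> 'a set) \<Rightarrow> (nat \<Rightarrow> nat) \<Rightarrow> nat \<Rightarrow> real" where
  "single_prob M C \<pi> i = measure M (C (\<pi> i))"

definition pair_prob :: "'a measure \<Rightarrow> (nat \<Rightarrow> 'a set) \<Rightarrow> (nat \<Rightarrow> nat) \<Rightarrow> nat \<Rightarrow> nat \<Rightarrow> real" where
  "pair_prob M C \<pi> i j = measure M (C (\<pi> i) \<inter> C (\<pi> j))"

text \<open>Indices are 1-based. The sums start at 3, so the sets under \<open>Max\<close> are finite and nonempty.\<close>

definition level1_bound :: "'a measure \<Rightarrow> (nat \<Rightarrow> 'a set) \<Rightarrow> nat \<Rightarrow> (nat \<Rightarrow> nat) \<Rightarrow> real" where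
  "level1_bound M C n \<pi> =
    single_prob M C \<pi> 1 + single_prob M C \<pi> 2 - pair_prob M C \<pi> 1 2
    + (\<Sum>i=3..n. single_prob M C \<pi> i - Max {pair_prob M C \<pi> j i |j. 1 \<le> j \<and> j < i})"

definition level2_bound :: "'a measure \<Rightarrow> (nat \<Rightarrow> 'a set) \<Rightarrow> nat \<Rightarrow> (nat \<Rightarrow> nat) \<Rightarrow> real" where
  "level2_bound M C n \<pi> =
    single_prob M C \<pi> 1 + single_prob M C \<pi> 2 - pair_prob M C \<pi> 1 2
    + (\<Sum>i=3..n. max (single_prob M C \<pi> i
        - Max {pair_prob M C \<pi> j i + pair_prob M C \<pi> l i
                 - min (pair_prob M C \<pi> j i) (min (pair_prob M C \<pi> l i) (pair_prob M C \<pi> l j))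
               |j l. 1 \<le> j \<and> j < l \<and> l < i}) 0)"

end

theory Submission imports Defs begin

text \<open>
  The two bounds are compared term by term. For a maximiser \<open>j\<close> of \<open>P\<^sub>j\<^sub>i\<close> and any other
  \<open>l < i\<close> one has \<open>P\<^sub>j\<^sub>i + P\<^sub>l\<^sub>i - min (P\<^sub>j\<^sub>i, P\<^sub>l\<^sub>i, P\<^sub>l\<^sub>j) \<ge> P\<^sub>j\<^sub>i\<close>, and the first-level terms are
  nonnegative, so no second-level term exceeds its first-level counterpart. At \<open>i = c\<close> the
  minimum for the pair \<open>a, b\<close> is \<open>P\<^sub>a\<^sub>b < P\<^sub>b\<^sub>c\<close>, so the quantity subtracted at level 2 is strictly
  larger; the first-level term there is positive because
  \<open>P\<^sub>c \<ge> P\<^sub>a\<^sub>c + P\<^sub>b\<^sub>c - P\<^sub>a\<^sub>b > P\<^sub>a\<^sub>c\<close>, hence truncation at 0 does not destroy strictness.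
\<close>

lemma pair_prob_commute: "pair_prob M C \<pi> i j = pair_prob M C \<pi> j i"
  by (simp add: pair_prob_def Int_commute)

text \<open>Inclusion-exclusion for \<open>A \<inter> D\<close> and \<open>B \<inter> D\<close>:
  their union lies in \<open>D\<close> and their intersection in
  \<open>A \<inter> B\<close>.\<close>

lemma (in finite_measure) measure_Int_add_le:
  assumes "A \<in> sets M" "B \<in> sets M" "D \<in> sets M"
  shows "measure M (A \<inter> D) + measure M (B \<inter> D) \<le> measure M D + measure M (A \<inter> B)"
proof -
  have "measure M (A \<inter> D) + measure M (B \<inter> D)
      = measure M ((A \<inter> D) \<union> (B \<inter> D)) + measure M ((A \<inter> D) \<inter> (B \<inter> D))"
    using assms measure_Un3[of "A \<inter> D" M "B \<inter> D"] by (simp add: fmeasurable_eq_sets)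
  moreover have "measure M ((A \<inter> D) \<union> (B \<inter> D)) \<le> measure M D"
    using assms by (intro finite_measure_mono) auto
  moreover have "measure M ((A \<inter> D) \<inter> (B \<inter> D)) \<le> measure M (A \<inter> B)"
    using assms by (intro finite_measure_mono) auto
  ultimately show ?thesis by linarith
qed

lemma finite_ordered_pair_image: "finite {f j l |j l. 1 \<le> j \<and> j < l \<and> l < (i::nat)}"
  by (rule finite_subset[of _ "(\<lambda>(j, l). f j l) ` ({..i} \<times> {..i})"]) auto

text \<open>The expression is symmetric in \<open>j\<close> and \<open>l\<close>, so two distinct
  indices may be used in either order although the set lists only pairs with \<open>j < l\<close>.
  This allows \<open>a\<close> and \<open>b\<close> to be used later without knowing which is
  smaller.\<close>

lemma level2_term_le_Max:
  assumes "1 \<le> j" "1 \<le> l" "j < i" "l < i" "j \<noteq> l"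
  shows "pair_prob M C \<pi> j i + pair_prob M C \<pi> l i
           - min (pair_prob M C \<pi> j i) (min (pair_prob M C \<pi> l i) (pair_prob M C \<pi> l j))
       \<le> Max {pair_prob M C \<pi> j i + pair_prob M C \<pi> l i
                 - min (pair_prob M C \<pi> j i) (min (pair_prob M C \<pi> l i) (pair_prob M C \<pi> l j))
               |j l. 1 \<le> j \<and> j < l \<and> l < i}" (is "?h j l \<le> Max ?S")
proof (rule Max_ge[OF finite_ordered_pair_image])
  have comm: "?h j l = ?h l j"
    by (simp add: pair_prob_commute[of _ _ _ l j] min.left_commute)
  have ordered: "?h j l \<in> ?S" if "1 \<le> j" "j < l" "l < i" for j l
    using that by blast
  show "?h j l \<in> ?S"
  proof (cases "j < l")
    case True
    then show ?thesis by (intro ordered) (use assms in auto)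
  next
    case False
    then show ?thesis
      unfolding comm by (intro ordered) (use assms in auto)
  qed
qed

lemma Max_level1_le_Max_level2:
  assumes "3 \<le> i"
  shows "Max {pair_prob M C \<pi> j i |j. 1 \<le> j \<and> j < i}
       \<le> Max {pair_prob M C \<pi> j i + pair_prob M C \<pi> l i
                 - min (pair_prob M C \<pi> j i) (min (pair_prob M C \<pi> l i) (pair_prob M C \<pi> l j))
               |j l. 1 \<le> j \<and> j < l \<and> l < i}" (is "Max ?S \<le> Max ?T")
proof (rule Max.boundedI)
  show "finite ?S" by simp
  show "?S \<noteq> {}" using assms by (auto intro: exI[of _ 1])
  fix x assume "x \<in> ?S"
  then obtain j where j: "x = pair_prob M C \<pi> j i" "1 \<le> j" "j < i" by blast
  \<comment> \<open>Any positive index below \<open>i\<close> other than \<open>j\<close> would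
    serve as partner; since \<open>3 \<le> i\<close>, both 1 and 2 are available.\<close>
  define l :: nat where "l = (if j = 1 then 2 else 1)"
  have "x \<le> pair_prob M C \<pi> j i + pair_prob M C \<pi> l i
      - min (pair_prob M C \<pi> j i) (min (pair_prob M C \<pi> l i) (pair_prob M C \<pi> l j))"
    using j(1) by simp
  also have "\<dots> \<le> Max ?T"
    by (rule level2_term_le_Max) (use j assms in \<open>auto simp: l_def\<close>)
  finally show "x \<le> Max ?T" .
qed

theorem theorem2:
  fixes M :: "'a measure" and C :: "nat \<Rightarrow> 'a set" and n :: nat and \<pi> :: "nat \<Rightarrow> nat"
    and a b c :: nat
  assumes "prob_space M"
    and "n \<ge> 3"
    and "\<And>i. i \<in> {1..n} \<Longrightarrow> C i \<in> sets M"
    and "\<pi> permutes {1..n}"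
    and "a \<in> {1..n}" and "b \<in> {1..n}" and "c \<in> {1..n}"
    and "a \<noteq> b" and "a \<noteq> c" and "b \<noteq> c"
    and "a < c" and "b < c"
    and "pair_prob M C \<pi> a c = Max {pair_prob M C \<pi> i c |i. 1 \<le> i \<and> i < c}"
    and "pair_prob M C \<pi> a c \<ge> pair_prob M C \<pi> b c"
    and "pair_prob M C \<pi> b c > pair_prob M C \<pi> a b"
  shows "level2_bound M C n \<pi> < level1_bound M C n \<pi>"
proof -
  interpret prob_space M by fact
  let ?P = "pair_prob M C \<pi>" and ?p = "single_prob M C \<pi>"
  let ?M1 = "\<lambda>i. Max {?P j i |j. 1 \<le> j \<and> j < i}"
  let ?M2 = "\<lambda>i. Max {?P j i + ?P l i - min (?P j i) (min (?P l i) (?P l j))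
                   |j l. 1 \<le> j \<and> j < l \<and> l < i}"
  have C: "C (\<pi> i) \<in> sets M" if "i \<in> {1..n}" for i
    using assms(3) permutes_in_image[OF assms(4)] that by blast
  have M1_le: "?M1 i \<le> ?p i" if "i \<in> {3..n}" for i
  proof (rule Max.boundedI)
    show "{?P j i |j. 1 \<le> j \<and> j < i} \<noteq> {}"
      using that by (auto intro: exI[of _ 1])
    show "x \<le> ?p i" if "x \<in> {?P j i |j. 1 \<le> j \<and> j < i}" for x
      using that C[of i] \<open>i \<in> {3..n}\<close>
      by (auto simp: pair_prob_def single_prob_def intro!: finite_measure_mono)
  qed simp
  have le: "max (?p i - ?M2 i) 0 \<le> ?p i - ?M1 i" if "i \<in> {3..n}" for i
    using M1_le[OF that] Max_level1_le_Max_level2[of i M C \<pi>] that by simp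
  \<comment> \<open>Two distinct positive indices \<open>a\<close> and \<open>b\<close> lie below
    \<open>c\<close>, so \<open>c\<close> is at least 3 and its term occurs in both sums.\<close>
  have c: "c \<in> {3..n}"
    using assms(5-12) by auto
  have "?P a c + ?P b c \<le> ?p c + ?P a b"
    unfolding pair_prob_def single_prob_def
    by (rule measure_Int_add_le) (use C assms(5-7) in auto)
  then have pos: "?M1 c < ?p c"
    using assms(13,15) by linarith
  have "?P a c < ?P a c + ?P b c - min (?P a c) (min (?P b c) (?P b a))"
    using assms(14,15) by (simp add: pair_prob_commute[of _ _ _ b a])
  also have "\<dots> \<le> ?M2 c"
    by (rule level2_term_le_Max) (use assms(5-12) in auto)
  finally have "max (?p c - ?M2 c) 0 < ?p c - ?M1 c"
    using pos assms(13) by simp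
  then have "(\<Sum>i=3..n. max (?p i - ?M2 i) 0) < (\<Sum>i=3..n. ?p i - ?M1 i)"
    using le c by (intro sum_strict_mono_ex1) auto
  then show ?thesis
    unfolding level1_bound_def level2_bound_def by simp
qed

end
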